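(* Let $\rho>0$, let $M\ge 2$, $N\ge 1$, $L\ge 1$ be integers, and let $\ell\in\{0,1,\dots,L-1\}$. Let $U=U(\Theta)$ be the $M\times M$ unitary matrix parameterized by $\Theta=(\phi_{pq},\nu_{pq},\theta_k)$ as described in the context, and let $\Phi$ be an $M\times M$ unitary matrix. Put $$\alpha=\frac{4(1+2\rho)}{\rho^2},\qquad \mathcal{Q}=[(\alpha+2)I-\Phi-\Phi^\dagger]^{-1}\Phi,\qquad \Lambda=\mathrm{diag}\big([e^{2\pi i\lambda_1/L},\dots,e^{2\pi i\lambda_M/L}]\big)$$ with real parameters $\lambda_1,\dots,\lambda_M$. Then $$P(I,\Phi)=\frac{\alpha^{MN}}{2\left(\det[(\alpha+2)I-\Phi-\Phi^\dagger]\right)^N},$$ $$\left.\frac{\partial P(U,\Phi)}{\partial\phi_{pq}}\right|_{\Theta=0}=2N\,P(I,\Phi)\,\Re\big([\mathcal{Q}]_{qp}-[\mathcal{Q}]_{pq}\big)\qquad(1\le p<q\le M),$$ $$\left.\frac{\partial P(U,\Phi)}{\partial\theta_k}\right|_{\Theta=0}=2N\,P(I,\Phi)\,\Im\big([\mathcal{Q}]_{kk}\big)\qquad(1\le k\le M),$$ $$\left.\frac{\partial P(U,\Phi)}{\partial\nu_{pq}}\right|_{\Theta=0}=0\qquad(1\le p<q\le M),$$ $$\left.\frac{\partial P(\Lambda^{\ell},\Phi)}{\partial\lambda_m}\right|_{\Lambda=I}=\frac{4\pi N\ell}{L}\,P(I,\Phi)\,\Im\big([\mathcal{Q}]_{mm}\big)\qquad(1\le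 m\le M),$$ where $\Theta=0$ means that all parameters in $\Theta$ are zero, and $\Lambda=I$ means $\lambda_1=\cdots=\lambda_M=0$.
   Context: $[X]_{pq}$ is the entry of $X$ in row $p$, column $q$; $X^\dagger$ is the conjugate transpose; $\Re,\Im$ denote real and imaginary parts; $i=\sqrt{-1}$; $I$ is the $M\times M$ identity. For $M\times M$ unitary matrices $V,V'$, the Chernoff bound on the pairwise error probability is $$P(V,V')=\frac12\prod_{m=1}^M\left[1+\frac{\rho^2\sigma_m^2}{4(1+2\rho)}\right]^{-N},$$ where $\sigma_1,\dots,\sigma_M$ are the singular values of $V-V'$ (with multiplicity). Parameterization of unitary matrices. $\Theta$ consists of the $M^2$ real parameters $\phi_{pq}$ and $\nu_{pq}$ ($1\le p<q\le M$) and $\theta_k$ ($1\le k\le M$), with $\phi_{pq}\in[-\frac\pi2,\frac\pi2]$ for $q\le M-1$, $\phi_{pM}\in[-\pi,\pi)$, $\nu_{pq}\in[-\frac\pi2,\frac\pi2]$, $\theta_k\in[-\frac\pi2,\frac\pi2]$ for $k\le M-1$, and $\theta_M\in[-\pi,\pi)$. For $1\le p<q\le M$, $U^{p,q}=U^{p,q}(\phi_{pq},\nu_{pq})$ is the $(M-p+1)\times(M-p+1)$ matrix with $$[U^{p,q}]_{jk}=\begin{cases}1,& j=k,\ j\notin\{1,q-p+1\}\\ \cos\phi_{pq},& j=k,\ j\in\{1,q-p+1\}\\ -\sin(\phi_{pq})e^{-i\nu_{pq}},& j=1,\ k=q-p+1\\ \sin(\phi_{pq})e^{i\nu_{pq}},&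 k=1,\ j=q-p+1\\ 0,&\text{otherwise.}\end{cases}$$ Let $F^r=U^{r,r+1}U^{r,r+2}\cdots U^{r,M}$ for $1\le r\le M-1$. Define recursively $$\mathscr{U}^1=\begin{bmatrix}e^{i\theta_{M-1}}&0\\0&e^{i\theta_M}\end{bmatrix},\qquad \mathscr{U}^{k+1}=\begin{bmatrix}e^{i\theta_{M-k-1}}&0\\0&\mathscr{U}^kF^{M-k}\end{bmatrix}\quad(k=1,\dots,M-2),$$ and $U(\Theta)=\mathscr{U}^{M-1}F^1$. *)

theory Defs
  imports
    "HOL-Computational_Algebra.Computational_Algebra"
    "Jordan_Normal_Form.Gauss_Jordan_Elimination"
    "Jordan_Normal_Form.Schur_Decomposition"
begin

(* Matrix entries are 0-based, while the parameters phi p q, nu p q, theta k and lambda m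
   keep their 1-based indices: the entry in row p and column q of A is A $$ (p - 1, q - 1). *)

definition unitary_mat :: "nat \<Rightarrow> complex mat \<Rightarrow> bool" where
  "unitary_mat n A \<longleftrightarrow>
     A \<in> carrier_mat n n \<and> A * mat_adjoint A = 1\<^sub>m n \<and> mat_adjoint A * A = 1\<^sub>m n"

(* The square roots of the eigenvalues, with algebraic multiplicity, of the positive
   semidefinite matrix A^dagger A; these eigenvalues are real, so taking Re is harmless. *)
definition singular_values :: "complex mat \<Rightarrow> real multiset" where
  "singular_values A =
     image_mset (\<lambda>e. sqrt (Re e)) (proots (char_poly (mat_adjoint A * A)))"

definition chernoff :: "real \<Rightarrow> nat \<Rightarrow> complex mat \<Rightarrow> complex mat \<Rightarrow> real" where
  "chernoff \<rho> N V V' = 1 / 2 *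
     (\<Prod>\<sigma>\<in>#singular_values (V - V'). (1 + \<rho>\<^sup>2 * \<sigma>\<^sup>2 / (4 * (1 + 2 * \<rho>))) powi (- int N))"

definition Upq :: "nat \<Rightarrow> (nat \<Rightarrow> nat \<Rightarrow> real) \<Rightarrow> (nat \<Rightarrow> nat \<Rightarrow> real) \<Rightarrow> nat \<Rightarrow> nat \<Rightarrow> complex mat" where
  "Upq M \<phi> \<nu> p q = mat (M - p + 1) (M - p + 1) (\<lambda>(j, k).
     if j = k \<and> j \<notin> {0, q - p} then 1
     else if j = k \<and> j \<in> {0, q - p} then complex_of_real (cos (\<phi> p q))
     else if j = 0 \<and> k = q - p then - complex_of_real (sin (\<phi> p q)) * cis (- \<nu> p q)
     else if k = 0 \<and> j = q - p then complex_of_real (sin (\<phi> p q)) * cis (\<nu> p q)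
     else 0)"

(* The ordered product U^{r,r+1} U^{r,r+2} ... U^{r,M}. *)
definition Fmat :: "nat \<Rightarrow> (nat \<Rightarrow> nat \<Rightarrow> real) \<Rightarrow> (nat \<Rightarrow> nat \<Rightarrow> real) \<Rightarrow> nat \<Rightarrow> complex mat" where
  "Fmat M \<phi> \<nu> r = foldr (\<lambda>q B. Upq M \<phi> \<nu> r q * B) [r + 1..<M + 1] (1\<^sub>m (M - r + 1))"

(* Defined from k = 1 on; the value at k = 0 is irrelevant.  The matrix for k has size k + 1. *)
fun scrU :: "nat \<Rightarrow> (nat \<Rightarrow> nat \<Rightarrow> real) \<Rightarrow> (nat \<Rightarrow> nat \<Rightarrow> real) \<Rightarrow> (nat \<Rightarrow> real) \<Rightarrow> nat \<Rightarrow> complex mat" where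
  "scrU M \<phi> \<nu> \<theta> (Suc 0) =
     four_block_mat
       (mat 1 1 (\<lambda>_. cis (\<theta> (M - 1)))) (0\<^sub>m 1 1)
       (0\<^sub>m 1 1) (mat 1 1 (\<lambda>_. cis (\<theta> M)))"
| "scrU M \<phi> \<nu> \<theta> (Suc (Suc k)) =
     four_block_mat
       (mat 1 1 (\<lambda>_. cis (\<theta> (M - Suc k - 1)))) (0\<^sub>m 1 (Suc k + 1))
       (0\<^sub>m (Suc k + 1) 1) (scrU M \<phi> \<nu> \<theta> (Suc k) * Fmat M \<phi> \<nu> (M - Suc k))"

(* U(Theta) for Theta = (phi, nu, theta), given by the same formula for all real angles.
   Zero is an interior point of every range to which the angles are restricted in the
   parameterization, so partial derivatives at Theta = 0 do not depend on the restriction.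
   Only phi p q, nu p q with 1 <= p < q <= M and theta k with 1 <= k <= M are used. *)
definition Upar :: "nat \<Rightarrow> (nat \<Rightarrow> nat \<Rightarrow> real) \<Rightarrow> (nat \<Rightarrow> nat \<Rightarrow> real) \<Rightarrow> (nat \<Rightarrow> real) \<Rightarrow> complex mat" where
  "Upar M \<phi> \<nu> \<theta> = scrU M \<phi> \<nu> \<theta> (M - 1) * Fmat M \<phi> \<nu> 1"

definition Lambda_mat :: "nat \<Rightarrow> nat \<Rightarrow> (nat \<Rightarrow> real) \<Rightarrow> complex mat" where
  "Lambda_mat M L lam = mat_diag M (\<lambda>j. cis (2 * pi * lam (j + 1) / real L))"

definition alpha :: "real \<Rightarrow> real" where
  "alpha \<rho> = 4 * (1 + 2 * \<rho>) / \<rho>\<^sup>2"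

definition Kmat :: "real \<Rightarrow> nat \<Rightarrow> complex mat \<Rightarrow> complex mat" where
  "Kmat \<rho> M \<Phi> = complex_of_real (alpha \<rho> + 2) \<cdot>\<^sub>m 1\<^sub>m M - \<Phi> - mat_adjoint \<Phi>"

(* For rho > 0 and unitary Phi the matrix Kmat is positive definite, so that
   mat_inverse does return an inverse. *)
definition Qmat :: "real \<Rightarrow> nat \<Rightarrow> complex mat \<Rightarrow> complex mat" where
  "Qmat \<rho> M \<Phi> = the (mat_inverse (Kmat \<rho> M \<Phi>)) * \<Phi>"

end

theory Submission
  imports Defs
begin

text \<open>For unitary \<open>V\<close> and \<open>\<Phi>\<close>, the product over the singular values of \<open>V - \<Phi>\<close> is the
  characteristic polynomial of the Gram matrix of \<open>V - \<Phi>\<close> at \<open>- \<alpha>\<close>, up to normalization, so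
  \<open>P(V, \<Phi>)\<close> is a multiple of the \<open>-N\<close>-th power of the determinant of
  \<open>K(V) = (\<alpha> + 2) I - V\<^sup>\<dagger> \<Phi> - \<Phi>\<^sup>\<dagger> V\<close>. Along a curve of unitary matrices through \<open>I\<close> with velocity \<open>D\<close>,
  one factors \<open>det K(V) = det K(I) \<cdot> det (K(I)\<^sup>-\<^sup>1 K(V))\<close>; the second determinant has derivative
  \<open>tr (K(I)\<^sup>-\<^sup>1 K'(0)) = - 2 Re tr (Q D\<^sup>\<dagger>)\<close>, since \<open>K(I)\<^sup>-\<^sup>1\<close> is Hermitian and commutes with \<open>\<Phi>\<close>. With a
  single nonzero parameter, \<open>U(\<Theta>)\<close> is a rotation in a coordinate plane, a diagonal phase matrix, or \<open>I\<close>.\<close>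

section \<open>Algebra of the conjugate transpose\<close>

lemma mat_adjoint_carrier [simp, intro]:
  "A \<in> carrier_mat n m \<Longrightarrow> mat_adjoint A \<in> carrier_mat m n"
  unfolding mat_adjoint_def by auto

lemma dim_mat_adjoint [simp]:
  "dim_row (mat_adjoint A) = dim_col A" "dim_col (mat_adjoint A) = dim_row A"
  unfolding mat_adjoint_def by auto

lemma index_mat_adjoint [simp]:
  "i < dim_col A \<Longrightarrow> j < dim_row A \<Longrightarrow> mat_adjoint A $$ (i, j) = conjugate (A $$ (j, i))"
  unfolding mat_adjoint_def by (simp add: mat_of_rows_def)

lemma mat_adjoint_adjoint [simp]: "mat_adjoint (mat_adjoint A) = A"
  by (rule eq_matI) auto

lemma mat_adjoint_one [simp]: "mat_adjoint (1\<^sub>m n) = (1\<^sub>m n :: complex mat)"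
  by (rule eq_matI) auto

lemma mat_adjoint_minus:
  fixes A B :: "complex mat"
  assumes "A \<in> carrier_mat n m" "B \<in> carrier_mat n m"
  shows "mat_adjoint (A - B) = mat_adjoint A - mat_adjoint B"
  using assms by (intro eq_matI) auto

lemma mat_adjoint_mult:
  fixes A B :: "complex mat"
  assumes "A \<in> carrier_mat n m" "B \<in> carrier_mat m k"
  shows "mat_adjoint (A * B) = mat_adjoint B * mat_adjoint A"
  using assms
  by (intro eq_matI) (auto simp: scalar_prod_def mult.commute intro!: sum.cong)

section \<open>Eigenvalues of Gram matrices, and the Chernoff bound as a determinant\<close>

lemma mat_adjoint_mult_vec_cscalar:
  fixes B :: "complex mat"
  assumes B: "B \<in> carrier_mat n m" and w: "w \<in> carrier_vec n" and v: "v \<in> carrier_vec m"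
  shows "(mat_adjoint B *\<^sub>v w) \<bullet>c v = w \<bullet>c (B *\<^sub>v v)"
proof -
  have "(mat_adjoint B *\<^sub>v w) \<bullet>c v = (\<Sum>j<m. \<Sum>i<n. cnj (B $$ (i, j)) * w $ i * cnj (v $ j))"
    using B w v by (auto simp: scalar_prod_def sum_distrib_right lessThan_atLeast0 intro!: sum.cong)
  also have "\<dots> = (\<Sum>i<n. \<Sum>j<m. cnj (B $$ (i, j)) * w $ i * cnj (v $ j))"
    by (rule sum.swap)
  also have "\<dots> = w \<bullet>c (B *\<^sub>v v)"
    using B w v by (auto simp: scalar_prod_def sum_distrib_left mult_ac lessThan_atLeast0 intro!: sum.cong)
  finally show ?thesis .
qed

text \<open>Rayleigh quotient argument: for an eigenvector v, the product of e with the positive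
  number \<open>v \<bullet>c v\<close> is the squared norm of \<open>A *\<^sub>v v\<close>.\<close>

lemma gram_eigenvalue_nonneg:
  fixes A :: "complex mat"
  assumes A: "A \<in> carrier_mat n m" and e: "eigenvalue (mat_adjoint A * A) e"
  shows "0 \<le> Re e" and "Im e = 0"
proof -
  obtain v where v: "v \<in> carrier_vec m" "v \<noteq> 0\<^sub>v m" "(mat_adjoint A * A) *\<^sub>v v = e \<cdot>\<^sub>v v"
    using e A unfolding eigenvalue_def eigenvector_def by auto
  have Av: "A *\<^sub>v v \<in> carrier_vec n" using A v by auto
  have "e * (v \<bullet>c v) = ((mat_adjoint A * A) *\<^sub>v v) \<bullet>c v"
    using v by simp
  also have "(mat_adjoint A * A) *\<^sub>v v = mat_adjoint A *\<^sub>v (A *\<^sub>v v)"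
    using A v by (intro assoc_mult_mat_vec) auto
  also have "\<dots> \<bullet>c v = (A *\<^sub>v v) \<bullet>c (A *\<^sub>v v)"
    by (rule mat_adjoint_mult_vec_cscalar[OF A Av v(1)])
  finally have eq: "e * (v \<bullet>c v) = (A *\<^sub>v v) \<bullet>c (A *\<^sub>v v)" .
  have c: "v \<bullet>c v > 0" using v by simp
  have "(A *\<^sub>v v) \<bullet>c (A *\<^sub>v v) \<ge> 0" by auto
  with eq have "e * (v \<bullet>c v) \<ge> 0" by simp
  \<comment> \<open>The order on complex numbers compares only numbers with equal imaginary parts,
    so nonnegativity also gives realness.\<close>
  then show "0 \<le> Re e" "Im e = 0"
    using c by (auto simp: less_eq_complex_def less_complex_def zero_le_mult_iff)
qed

lemma prod_mset_power_int:
  "(\<Prod>x\<in>#S. f x powi k) = (\<Prod>x\<in>#S. f x :: real) powi k"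
  by (induction S) (auto simp: power_int_mult_distrib)

text \<open>With \<sigma>^2 running over the Gram eigenvalues, each factor of the bound is (\<alpha>
  + \<sigma>^2) / \<alpha>, and the product of the numerators is \<open>D\<close>. Unitarity is not
  involved yet.\<close>

lemma chernoff_eq_det:
  fixes V W :: "complex mat"
  assumes \<rho>: "\<rho> > 0" and V: "V \<in> carrier_mat n n" and W: "W \<in> carrier_mat n n"
  defines "D \<equiv> det (complex_of_real (alpha \<rho>) \<cdot>\<^sub>m 1\<^sub>m n + mat_adjoint (V - W) * (V - W))"
  shows "Im D = 0" and "Re D > 0"
    and "chernoff \<rho> N V W = alpha \<rho> ^ (n * N) / (2 * Re D ^ N)"
proof -
  define A where "A = V - W"
  define B where "B = mat_adjoint A * A"
  define a where "a = alpha \<rho>"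
  have a: "a > 0" using \<rho> by (simp add: a_def alpha_def)
  have A: "A \<in> carrier_mat n n" and B: "B \<in> carrier_mat n n"
    using V W by (auto simp: A_def B_def)
  \<comment> \<open>The list \<open>es\<close> holds the complex eigenvalues of the Gram matrix with
    multiplicity.\<close>
  obtain es where es: "char_poly B = (\<Prod>e\<leftarrow>es. [:- e, 1:])" and len: "length es = n"
    using char_poly_factorized[OF B] by blast
  have real: "0 \<le> Re e \<and> e = complex_of_real (Re e)" if "e \<in> set es" for e
  proof -
    have "poly (char_poly B) e = 0"
      using that unfolding es by (auto simp: poly_prod_list prod_list_zero_iff)
    then have "eigenvalue B e" using eigenvalue_root_char_poly[OF B] by simp
    then show ?thesis
      using gram_eigenvalue_nonneg[OF A] unfolding B_def by (auto simp: complex_eq_iff)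
  qed
  \<comment> \<open>The characteristic polynomial at x is det(x I - B). At x = -a this yields the
    sign (-1)^n, which cancels against the same sign from the linear factors.\<close>
  have "- char_matrix B (- complex_of_real a) = (-1) \<cdot>\<^sub>m (complex_of_real a \<cdot>\<^sub>m 1\<^sub>m n + B)"
    using B by (intro eq_matI) (auto simp: char_matrix_def)
  then have "poly (char_poly B) (- complex_of_real a) = (-1) ^ n * D"
    unfolding char_poly_matrix[OF B] D_def A_def[symmetric] B_def[symmetric] a_def[symmetric]
    using B by simp
  moreover have "poly (char_poly B) (- complex_of_real a)
      = (-1) ^ n * (\<Prod>e\<leftarrow>es. complex_of_real a + e)"
  proof -
    have "(\<Prod>e\<leftarrow>fs. - e - complex_of_real a) = (-1) ^ length fs * (\<Prod>e\<leftarrow>fs. complex_of_real a + e)" for fs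
      by (induction fs) (auto simp: algebra_simps)
    then show ?thesis unfolding es len[symmetric] by (simp add: poly_prod_list o_def)
  qed
  ultimately have "D = (\<Prod>e\<leftarrow>es. complex_of_real a + e)" by simp
  also have "\<dots> = (\<Prod>e\<leftarrow>es. complex_of_real (a + Re e))"
    using real by (intro arg_cong[where f = prod_list] map_cong) auto
  also have "\<dots> = complex_of_real (\<Prod>e\<leftarrow>es. a + Re e)"
    by (induction es) auto
  finally have D: "D = complex_of_real (\<Prod>e\<leftarrow>es. a + Re e)" .
  \<comment> \<open>Stated for lists with elements in \<open>set es\<close>, so that the facts
    \<open>real\<close> remain available while the induction passes to tails.\<close>
  have "(\<Prod>e\<leftarrow>fs. a + Re e) > 0" if "set fs \<subseteq> set es" for fs
    using that by (induction fs) (use real a in \<open>auto intro!: mult_pos_pos add_pos_nonneg\<close>)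
  then show "Re D > 0" "Im D = 0" using D by auto
  have "proots (\<Prod>e\<leftarrow>fs. [:- e, 1:]) = mset fs" for fs :: "complex list"
  proof (induction fs)
    case (Cons e fs)
    have "(\<Prod>e\<leftarrow>fs. [:- e, 1:]) \<noteq> 0"
      by (auto simp: prod_list_zero_iff)
    then have "proots ([:- e, 1:] * (\<Prod>e\<leftarrow>fs. [:- e, 1:])) = proots [:- e, 1:] + mset fs"
      using Cons by (subst proots_mult) auto
    then show ?case by simp
  qed simp
  then have roots: "proots (char_poly B) = mset es"
    unfolding es .
  \<comment> \<open>The coefficient of the squared singular value is 1 / \<alpha>. Squaring undoes
    \<open>sqrt\<close> because \<open>Re e\<close> is nonnegative.\<close>
  have fac: "1 + \<rho>\<^sup>2 * (sqrt (Re e))\<^sup>2 / (4 * (1 + 2 * \<rho>)) = (a + Re e) / a" if "e \<in> set es" for e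
  proof -
    have "\<rho>\<^sup>2 / (4 * (1 + 2 * \<rho>)) = 1 / a"
      by (simp add: a_def alpha_def)
    then have "\<rho>\<^sup>2 * (sqrt (Re e))\<^sup>2 / (4 * (1 + 2 * \<rho>)) = Re e / a"
      using real[OF that] by (metis mult.commute mult_1 real_sqrt_pow2 times_divide_eq_left times_divide_eq_right)
    then show ?thesis using a by (simp add: field_simps)
  qed
  have "(\<Prod>e\<leftarrow>es. 1 + \<rho>\<^sup>2 * (sqrt (Re e))\<^sup>2 / (4 * (1 + 2 * \<rho>))) = (\<Prod>e\<leftarrow>es. (a + Re e) / a)"
    using fac by (intro arg_cong[where f = prod_list] map_cong) auto
  also have "\<dots> = (\<Prod>e\<leftarrow>es. a + Re e) / a ^ length es"
    by (induction es) auto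
  also have "\<dots> = Re D / a ^ n" using D len by simp
  finally have *: "(\<Prod>e\<leftarrow>es. 1 + \<rho>\<^sup>2 * (sqrt (Re e))\<^sup>2 / (4 * (1 + 2 * \<rho>))) = Re D / a ^ n" .
  have "chernoff \<rho> N V W = 1 / 2 * (Re D / a ^ n) powi (- int N)"
    unfolding chernoff_def singular_values_def A_def[symmetric] B_def[symmetric] roots
      prod_mset_power_int *[symmetric]
    by (simp add: image_mset.compositionality o_def flip: mset_map prod_mset_prod_list)
  also have "\<dots> = alpha \<rho> ^ (n * N) / (2 * Re D ^ N)"
    by (simp add: power_int_minus power_divide power_mult a_def)
  finally show "chernoff \<rho> N V W = alpha \<rho> ^ (n * N) / (2 * Re D ^ N)" .
qed

text \<open>Expanding the Gram matrix, the two diagonal terms are identities by unitarity; they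
  account for the 2 in \<alpha> + 2.\<close>

lemma unitary_gram_shift:
  fixes V W :: "complex mat"
  assumes V: "unitary_mat n V" and W: "unitary_mat n W"
  shows "complex_of_real a \<cdot>\<^sub>m 1\<^sub>m n + mat_adjoint (V - W) * (V - W)
    = complex_of_real (a + 2) \<cdot>\<^sub>m 1\<^sub>m n - mat_adjoint V * W - mat_adjoint W * V"
proof -
  have c: "V \<in> carrier_mat n n" "W \<in> carrier_mat n n"
    using V W by (auto simp: unitary_mat_def)
  then have a: "mat_adjoint V \<in> carrier_mat n n" "mat_adjoint W \<in> carrier_mat n n" by auto
  have "mat_adjoint (V - W) * (V - W)
      = (mat_adjoint V * V - mat_adjoint V * W) - (mat_adjoint W * V - mat_adjoint W * W)"
    unfolding mat_adjoint_minus[OF c] minus_mult_distrib_mat[OF a minus_carrier_mat[OF c(2)]]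
    by (simp only: mult_minus_distrib_mat[OF a(1) c] mult_minus_distrib_mat[OF a(2) c])
  then have *: "mat_adjoint (V - W) * (V - W)
      = (1\<^sub>m n - mat_adjoint V * W) - (mat_adjoint W * V - 1\<^sub>m n)"
    using V W by (simp add: unitary_mat_def)
  have "mat_adjoint V * W \<in> carrier_mat n n" "mat_adjoint W * V \<in> carrier_mat n n"
    using c a by auto
  then show ?thesis unfolding *
    by (intro eq_matI) (auto simp del: index_mult_mat)
qed

section \<open>Derivatives of determinants and of matrix-valued curves\<close>

text \<open>Jacobi's formula at the identity. In the Leibniz expansion a permutation other than
  \<open>id\<close> moves at least two points, so after differentiating one factor another
  off-diagonal entry of I remains and the term vanishes.\<close>

lemma has_vector_derivative_det_at_one:
  fixes B :: "real \<Rightarrow> 'a :: real_normed_field mat"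
  assumes B: "\<And>t. B t \<in> carrier_mat n n" and one: "B x = 1\<^sub>m n"
    and deriv: "\<And>i j. i < n \<Longrightarrow> j < n \<Longrightarrow> ((\<lambda>t. B t $$ (i, j)) has_vector_derivative E i j) (at x)"
  shows "((\<lambda>t. det (B t)) has_vector_derivative (\<Sum>i<n. E i i)) (at x)"
proof -
  let ?I = "{0..<n}"
  let ?P = "{p. p permutes ?I}"
  \<comment> \<open>\<open>T p\<close> is what the product rule gives for the Leibniz term of
    \<open>p\<close>, without its sign.\<close>
  define T where "T p = (\<Sum>i\<in>?I. E i (p i) * (\<Prod>j\<in>?I - {i}. B x $$ (j, p j)))" for p
  have "((\<lambda>t. \<Prod>i\<in>?I. B t $$ (i, p i)) has_vector_derivative T p) (at x)" if p: "p permutes ?I" for p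
  proof -
    have "((\<lambda>t. B t $$ (i, p i)) has_derivative (\<lambda>h. h *\<^sub>R E i (p i))) (at x)" if "i \<in> ?I" for i
      using deriv[of i "p i"] that permutes_in_image[OF p, of i]
      by (simp add: has_vector_derivative_def)
    then have "((\<lambda>t. \<Prod>i\<in>?I. B t $$ (i, p i)) has_derivative
      (\<lambda>h. \<Sum>i\<in>?I. (h *\<^sub>R E i (p i)) * (\<Prod>j\<in>?I - {i}. B x $$ (j, p j)))) (at x)"
      by (rule has_derivative_prod)
    then show ?thesis
      by (simp add: has_vector_derivative_def T_def scaleR_sum_right)
  qed
  then have "((\<lambda>t. \<Sum>p\<in>?P. signof p * (\<Prod>i\<in>?I. B t $$ (i, p i)))
      has_vector_derivative (\<Sum>p\<in>?P. signof p * T p)) (at x)"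
    by (intro has_vector_derivative_sum has_vector_derivative_mult_right) auto
  moreover have "T p = 0" if p: "p permutes ?I" and "p \<noteq> id" for p
    unfolding T_def
  proof (intro sum.neutral ballI)
    fix i assume i: "i \<in> ?I"
    obtain k where k: "p k \<noteq> k" using \<open>p \<noteq> id\<close> by (auto simp: fun_eq_iff)
    \<comment> \<open>a permutation cannot move exactly one point, so some factor other than the i-th vanishes\<close>
    obtain j where j: "j \<noteq> i" "p j \<noteq> j"
      using k permutes_inj[OF p] by (metis injD)
    then have "j \<in> ?I" "p j \<in> ?I"
      using p permutes_in_image[OF p] by (auto simp: permutes_def)
    then have "(\<Prod>j\<in>?I - {i}. B x $$ (j, p j)) = 0"
      using j one by (intro prod_zero bexI[of _ j]) auto
    then show "E i (p i) * (\<Prod>j\<in>?I - {i}. B x $$ (j, p j)) = 0" by simp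
  qed
  then have "(\<Sum>p\<in>?P. signof p * T p) = (\<Sum>p\<in>{id}. signof p * T p)"
    by (intro sum.mono_neutral_right) (auto simp: finite_permutations permutes_id)
  moreover have "T id = (\<Sum>i<n. E i i)"
    by (simp add: T_def one lessThan_atLeast0)
  moreover have "det (B t) = (\<Sum>p\<in>?P. signof p * (\<Prod>i\<in>?I. B t $$ (i, p i)))" for t
    by (rule det_def'[OF B])
  ultimately show ?thesis by simp
qed

text \<open>Differentiation is entrywise. The dimensions are part of the predicate, so that the
  rules below compose without separate side conditions on the curves.\<close>

definition has_mat_derivative :: "(real \<Rightarrow> complex mat) \<Rightarrow> nat \<Rightarrow> complex mat \<Rightarrow> real \<Rightarrow> bool" where
  "has_mat_derivative F n F' x \<longleftrightarrow>
     (\<forall>t. F t \<in> carrier_mat n n) \<and> F' \<in> carrier_mat n n \<and>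
     (\<forall>i<n. \<forall>j<n. ((\<lambda>t. F t $$ (i, j)) has_vector_derivative F' $$ (i, j)) (at x))"

lemma has_mat_derivative_const:
  "A \<in> carrier_mat n n \<Longrightarrow> has_mat_derivative (\<lambda>_. A) n (0\<^sub>m n n) x"
  by (auto simp: has_mat_derivative_def)

lemma has_mat_derivative_minus:
  assumes "has_mat_derivative F n F' x" "has_mat_derivative G n G' x"
  shows "has_mat_derivative (\<lambda>t. F t - G t) n (F' - G') x"
  unfolding has_mat_derivative_def
proof (intro conjI allI impI)
  fix i j assume ij: "i < n" "j < n"
  have *: "((\<lambda>t. F t $$ (i, j) - G t $$ (i, j)) has_vector_derivative F' $$ (i, j) - G' $$ (i, j)) (at x)"
    using assms ij unfolding has_mat_derivative_def by (intro has_vector_derivative_diff) auto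
  have c: "G t \<in> carrier_mat n n" "G' \<in> carrier_mat n n" for t
    using assms unfolding has_mat_derivative_def by auto
  have "(A - B) $$ (i, j) = A $$ (i, j) - B $$ (i, j)" if "B \<in> carrier_mat n n" for A B :: "complex mat"
    using that ij by auto
  with * show "((\<lambda>t. (F t - G t) $$ (i, j)) has_vector_derivative (F' - G') $$ (i, j)) (at x)"
    using c by simp
qed (use assms in \<open>auto simp: has_mat_derivative_def intro: minus_carrier_mat\<close>)

lemma has_mat_derivative_mult:
  assumes "has_mat_derivative F n F' x" "has_mat_derivative G n G' x"
  shows "has_mat_derivative (\<lambda>t. F t * G t) n (F x * G' + F' * G x) x"
  unfolding has_mat_derivative_def
proof (intro conjI allI impI)
  fix i j assume ij: "i < n" "j < n"
  have c: "F t \<in> carrier_mat n n" "G t \<in> carrier_mat n n" "F' \<in> carrier_mat n n" "G' \<in> carrier_mat n n" for t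
    using assms unfolding has_mat_derivative_def by auto
  have *: "((\<lambda>t. \<Sum>k<n. F t $$ (i, k) * G t $$ (k, j)) has_vector_derivative
      (\<Sum>k<n. F x $$ (i, k) * G' $$ (k, j) + F' $$ (i, k) * G x $$ (k, j))) (at x)"
    using assms ij unfolding has_mat_derivative_def
    by (intro has_vector_derivative_sum has_vector_derivative_mult) auto
  have mult: "(A * B) $$ (i, j) = (\<Sum>k<n. A $$ (i, k) * B $$ (k, j))"
    if "A \<in> carrier_mat n n" "B \<in> carrier_mat n n" for A B :: "complex mat"
    using that ij by (auto simp: scalar_prod_def lessThan_atLeast0)
  have "(F x * G' + F' * G x) $$ (i, j) = (F x * G') $$ (i, j) + (F' * G x) $$ (i, j)"
    using ij c(2)[of x] c(3) by (intro index_add_mat(1)) auto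
  with * show "((\<lambda>t. (F t * G t) $$ (i, j)) has_vector_derivative (F x * G' + F' * G x) $$ (i, j)) (at x)"
    using c by (simp add: mult sum.distrib)
qed (use assms in \<open>auto simp: has_mat_derivative_def intro!: add_carrier_mat mult_carrier_mat\<close>)

lemma has_mat_derivative_mult_left:
  assumes A: "A \<in> carrier_mat n n" and F: "has_mat_derivative F n F' x"
  shows "has_mat_derivative (\<lambda>t. A * F t) n (A * F') x"
proof -
  have "F' \<in> carrier_mat n n" "F x \<in> carrier_mat n n" using F by (auto simp: has_mat_derivative_def)
  then show ?thesis
    using has_mat_derivative_mult[OF has_mat_derivative_const[OF A] F] A by simp
qed

lemma has_mat_derivative_mult_right:
  assumes A: "A \<in> carrier_mat n n" and F: "has_mat_derivative F n F' x"
  shows "has_mat_derivative (\<lambda>t. F t * A) n (F' * A) x"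
proof -
  have "F' \<in> carrier_mat n n" "F x \<in> carrier_mat n n" using F by (auto simp: has_mat_derivative_def)
  then show ?thesis
    using has_mat_derivative_mult[OF F has_mat_derivative_const[OF A]] A by simp
qed

text \<open>The variable is real, so complex conjugation commutes with differentiation.\<close>

lemma has_mat_derivative_adjoint:
  assumes "has_mat_derivative F n F' x"
  shows "has_mat_derivative (\<lambda>t. mat_adjoint (F t)) n (mat_adjoint F') x"
  unfolding has_mat_derivative_def
proof (intro conjI allI impI)
  fix i j assume ij: "i < n" "j < n"
  have c: "F t \<in> carrier_mat n n" "F' \<in> carrier_mat n n" for t
    using assms unfolding has_mat_derivative_def by auto
  have "((\<lambda>t. cnj (F t $$ (j, i))) has_vector_derivative cnj (F' $$ (j, i))) (at x)"
    using assms ij unfolding has_mat_derivative_def by (intro has_vector_derivative_cnj) auto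
  moreover have "mat_adjoint A $$ (i, j) = cnj (A $$ (j, i))" if "A \<in> carrier_mat n n" for A :: "complex mat"
    using that ij by simp
  ultimately show "((\<lambda>t. mat_adjoint (F t) $$ (i, j)) has_vector_derivative mat_adjoint F' $$ (i, j)) (at x)"
    using c by simp
qed (use assms in \<open>auto simp: has_mat_derivative_def\<close>)

section \<open>The trace\<close>

definition mat_trace :: "'a :: comm_ring_1 mat \<Rightarrow> 'a" where
  "mat_trace A = (\<Sum>i<dim_row A. A $$ (i, i))"

lemma mat_trace_mult:
  assumes "A \<in> carrier_mat n m" "B \<in> carrier_mat m n"
  shows "mat_trace (A * B) = (\<Sum>i<n. \<Sum>j<m. A $$ (i, j) * B $$ (j, i))"
  using assms by (auto simp: mat_trace_def scalar_prod_def lessThan_atLeast0 intro!: sum.cong)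

lemma mat_trace_comm:
  assumes "A \<in> carrier_mat n m" "B \<in> carrier_mat m n"
  shows "mat_trace (A * B) = mat_trace (B * A)"
  unfolding mat_trace_mult[OF assms] mat_trace_mult[OF assms(2,1)]
  by (subst sum.swap) (simp add: mult.commute)

lemma mat_trace_minus:
  assumes "A \<in> carrier_mat n n" "B \<in> carrier_mat n n"
  shows "mat_trace (A - B) = mat_trace A - mat_trace B"
  using assms by (auto simp: mat_trace_def sum_subtractf)

lemma mat_trace_adjoint:
  "A \<in> carrier_mat n n \<Longrightarrow> mat_trace (mat_adjoint A) = cnj (mat_trace A)"
  by (auto simp: mat_trace_def)

section \<open>The bound for unitary matrices, and its derivative along a curve through the
  identity\<close>

lemma unitary_mat_one: "unitary_mat n (1\<^sub>m n)"
  by (simp add: unitary_mat_def)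

text \<open>In this form the matrix under the determinant depends real-affinely on \<open>V\<close>,
  which makes it easy to differentiate along curves of unitary matrices.\<close>

lemma chernoff_unitary:
  fixes V \<Phi> :: "complex mat"
  assumes \<rho>: "\<rho> > 0" and V: "unitary_mat n V" and \<Phi>: "unitary_mat n \<Phi>"
  defines "D \<equiv> det (complex_of_real (alpha \<rho> + 2) \<cdot>\<^sub>m 1\<^sub>m n - mat_adjoint V * \<Phi> - mat_adjoint \<Phi> * V)"
  shows "Im D = 0" and "Re D > 0"
    and "chernoff \<rho> N V \<Phi> = alpha \<rho> ^ (n * N) / (2 * Re D ^ N)"
proof -
  have c: "V \<in> carrier_mat n n" "\<Phi> \<in> carrier_mat n n"
    using V \<Phi> by (auto simp: unitary_mat_def)
  show "Im D = 0" "Re D > 0" "chernoff \<rho> N V \<Phi> = alpha \<rho> ^ (n * N) / (2 * Re D ^ N)"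
    using chernoff_eq_det[OF \<rho> c] by (simp_all only: D_def unitary_gram_shift[OF V \<Phi>])
qed

lemma Kmat_carrier: "\<Phi> \<in> carrier_mat n n \<Longrightarrow> Kmat \<rho> n \<Phi> \<in> carrier_mat n n"
  by (auto simp: Kmat_def)

lemma chernoff_one:
  assumes \<rho>: "\<rho> > 0" and \<Phi>: "unitary_mat n \<Phi>"
  shows "Im (det (Kmat \<rho> n \<Phi>)) = 0" and "Re (det (Kmat \<rho> n \<Phi>)) > 0"
    and "chernoff \<rho> N (1\<^sub>m n) \<Phi> = alpha \<rho> ^ (n * N) / (2 * Re (det (Kmat \<rho> n \<Phi>)) ^ N)"
proof -
  have "\<Phi> \<in> carrier_mat n n" using \<Phi> by (simp add: unitary_mat_def)
  then have "Kmat \<rho> n \<Phi> = complex_of_real (alpha \<rho> + 2) \<cdot>\<^sub>m 1\<^sub>m n - mat_adjoint (1\<^sub>m n) * \<Phi> - mat_adjoint \<Phi> * 1\<^sub>m n"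
    by (simp add: Kmat_def)
  then show "Im (det (Kmat \<rho> n \<Phi>)) = 0" "Re (det (Kmat \<rho> n \<Phi>)) > 0"
    "chernoff \<rho> N (1\<^sub>m n) \<Phi> = alpha \<rho> ^ (n * N) / (2 * Re (det (Kmat \<rho> n \<Phi>)) ^ N)"
    using chernoff_unitary[OF \<rho> unitary_mat_one \<Phi>] by simp_all
qed

text \<open>\<open>K\<close> is Hermitian and built from \<open>\<Phi>\<close> and its adjoint,
  which commute by unitarity. Being Hermitian and commuting with \<open>\<Phi>\<close> both pass to
  the inverse.\<close>

lemma Kmat_inverse:
  assumes \<rho>: "\<rho> > 0" and \<Phi>: "unitary_mat n \<Phi>"
  defines "K \<equiv> Kmat \<rho> n \<Phi>"
  defines "R \<equiv> the (mat_inverse K)"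
  shows "R \<in> carrier_mat n n" "K * R = 1\<^sub>m n" "R * K = 1\<^sub>m n"
    and "mat_adjoint R = R" and "\<Phi> * R = R * \<Phi>"
proof -
  have c: "\<Phi> \<in> carrier_mat n n" using \<Phi> by (simp add: unitary_mat_def)
  have K: "K \<in> carrier_mat n n" unfolding K_def by (rule Kmat_carrier[OF c])
  have "det K \<noteq> 0" using chernoff_one(2)[OF \<rho> \<Phi>] unfolding K_def by auto
  \<comment> \<open>\<open>mat_inverse\<close> returns \<open>None\<close> only on matrices that are
    not units, so this guarantees that \<open>the\<close> is applied to a
    \<open>Some\<close>.\<close>
  then have "K \<in> Units (ring_mat TYPE(complex) n ())"
    using det_non_zero_imp_unit[OF K] by simp
  then obtain S where "mat_inverse K = Some S"
    using mat_inverse(1)[OF K, of "()"] by (cases "mat_inverse K") auto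
  then show R: "R \<in> carrier_mat n n" "K * R = 1\<^sub>m n" "R * K = 1\<^sub>m n"
    using mat_inverse(2)[OF K] by (auto simp: R_def)
  have adjK: "mat_adjoint K = K"
    using c by (intro eq_matI) (auto simp: K_def Kmat_def)
  \<comment> \<open>Since \<open>K\<close> is self-adjoint, the adjoint of \<open>R\<close> is a
    left inverse of \<open>K\<close>, and a left inverse equals the right inverse
    \<open>R\<close>.\<close>
  have "mat_adjoint R = mat_adjoint R * (K * R)" using R by simp
  also have "\<dots> = (mat_adjoint R * mat_adjoint K) * R"
    using R K adjK by (simp add: assoc_mult_mat[of _ n n _ n _ n])
  also have "mat_adjoint R * mat_adjoint K = 1\<^sub>m n"
    using mat_adjoint_mult[OF K R(1)] R by simp
  finally show "mat_adjoint R = R" using R by simp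
  have "K * \<Phi> = complex_of_real (alpha \<rho> + 2) \<cdot>\<^sub>m \<Phi> - \<Phi> * \<Phi> - mat_adjoint \<Phi> * \<Phi>"
    using c by (simp add: K_def Kmat_def minus_mult_distrib_mat[of _ n n _ _ n] minus_carrier_mat
        mult_smult_assoc_mat[of _ n n _ n])
  \<comment> \<open>The two products differ only in the order of \<open>\<Phi>\<close> and its
    adjoint in the last term, which is the identity either way.\<close>
  also have "\<dots> = \<Phi> * K"
    using c \<Phi> by (simp add: K_def Kmat_def mult_minus_distrib_mat[of _ n n _ n] minus_carrier_mat
        mult_smult_distrib[of _ n n _ n] unitary_mat_def)
  finally have comm: "K * \<Phi> = \<Phi> * K" .
  have "R * \<Phi> = R * (\<Phi> * (K * R))" using R c by simp
  also have "\<dots> = R * ((\<Phi> * K) * R)"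
    using R c K by (simp add: assoc_mult_mat[of _ n n _ n _ n])
  also have "\<dots> = (R * K) * (\<Phi> * R)"
    unfolding comm[symmetric] using R(1) c K by (simp add: assoc_mult_mat[of _ n n _ n _ n])
  finally show "\<Phi> * R = R * \<Phi>" using R c by simp
qed

text \<open>The determinant normalized by \<open>R\<close> has value 1 and slope -2 Re \<tau> at 0,
  so its power with exponent -N has slope 2 N Re \<tau>. Only the velocity \<open>D\<close> enters,
  so one statement serves every parameter.\<close>

lemma chernoff_has_derivative_at_one:
  assumes \<rho>: "\<rho> > 0" and \<Phi>: "unitary_mat n \<Phi>"
    and V: "\<And>t. unitary_mat n (V t)" and V0: "V 0 = 1\<^sub>m n" and D: "has_mat_derivative V n D 0"
  shows "((\<lambda>t. chernoff \<rho> N (V t) \<Phi>) has_real_derivative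
    2 * real N * chernoff \<rho> N (1\<^sub>m n) \<Phi> * Re (mat_trace (Qmat \<rho> n \<Phi> * mat_adjoint D))) (at 0)"
proof -
  define K where "K = Kmat \<rho> n \<Phi>"
  define R where "R = the (mat_inverse K)"
  define C where "C = complex_of_real (alpha \<rho> + 2) \<cdot>\<^sub>m 1\<^sub>m n"
  define Kt where "Kt t = C - mat_adjoint (V t) * \<Phi> - mat_adjoint \<Phi> * V t" for t
  \<comment> \<open>The velocity at 0 of the curve \<open>R * Kt t\<close>, which passes through the
    identity there; the zero matrix comes from the constant term \<open>C\<close>.\<close>
  define E where "E = R * (0\<^sub>m n n - mat_adjoint D * \<Phi> - mat_adjoint \<Phi> * D)"
  define \<tau> where "\<tau> = mat_trace (Qmat \<rho> n \<Phi> * mat_adjoint D)"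
  define d where "d = Re (det K)"
  note R = Kmat_inverse[OF \<rho> \<Phi>, folded K_def, folded R_def]
  have c: "\<Phi> \<in> carrier_mat n n" "mat_adjoint \<Phi> \<in> carrier_mat n n"
    "D \<in> carrier_mat n n" "mat_adjoint D \<in> carrier_mat n n"
    "C \<in> carrier_mat n n" "V t \<in> carrier_mat n n" "mat_adjoint (V t) \<in> carrier_mat n n" for t
    using \<Phi> D V[of t] by (auto simp: unitary_mat_def has_mat_derivative_def C_def)
  have K: "K \<in> carrier_mat n n" unfolding K_def by (rule Kmat_carrier[OF c(1)])
  have Kt: "Kt t \<in> carrier_mat n n" for t
    unfolding Kt_def by (intro minus_carrier_mat mult_carrier_mat[OF c(2,6)])
  have "has_mat_derivative (\<lambda>t. R * Kt t) n E 0"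
    unfolding Kt_def E_def
    by (intro has_mat_derivative_mult_left has_mat_derivative_mult_right has_mat_derivative_minus
        has_mat_derivative_const has_mat_derivative_adjoint c R D)
  moreover have "Kt 0 = K"
    using c by (simp add: Kt_def K_def Kmat_def C_def V0)
  ultimately have "((\<lambda>t. det (R * Kt t)) has_vector_derivative (\<Sum>i<n. E $$ (i, i))) (at 0)"
    using R by (intro has_vector_derivative_det_at_one) (auto simp: has_mat_derivative_def)
  moreover have "(\<Sum>i<n. E $$ (i, i)) = mat_trace E"
    using R by (simp add: mat_trace_def E_def)
  moreover have "mat_trace E = - \<tau> - cnj \<tau>"
  proof -
    have c': "mat_adjoint D * \<Phi> \<in> carrier_mat n n" "mat_adjoint \<Phi> * D \<in> carrier_mat n n"
      using c by auto
    \<comment> \<open>Here \<open>\<Phi>\<close> and \<open>R\<close> are exchanged, so that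
      \<open>R * \<Phi>\<close>, which is \<open>Qmat\<close>, appears.\<close>
    have "(mat_adjoint D * \<Phi>) * R = mat_adjoint D * (R * \<Phi>)"
      using c R by (simp add: assoc_mult_mat[of _ n n _ n _ n])
    moreover have "mat_trace (mat_adjoint D * (R * \<Phi>)) = \<tau>"
      unfolding \<tau>_def Qmat_def K_def[symmetric] R_def[symmetric]
      using c R by (intro mat_trace_comm) auto
    ultimately have 1: "mat_trace ((mat_adjoint D * \<Phi>) * R) = \<tau>" by simp
    have 2: "mat_trace (R * (mat_adjoint D * \<Phi>)) = \<tau>"
      using mat_trace_comm[OF R(1) c'(1)] 1 by simp
    \<comment> \<open>As \<open>R\<close> is self-adjoint, the second term of \<open>E\<close> is
      the adjoint of the product treated in \<open>1\<close>, so its trace is the conjugate of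
      \<tau>.\<close>
    have "mat_adjoint ((mat_adjoint D * \<Phi>) * R) = R * (mat_adjoint \<Phi> * D)"
      using mat_adjoint_mult[OF c'(1) R(1)] mat_adjoint_mult[OF c(4,1)] R by simp
    then have 3: "mat_trace (R * (mat_adjoint \<Phi> * D)) = cnj \<tau>"
      using mat_trace_adjoint[of "(mat_adjoint D * \<Phi>) * R" n] 1 c' R by simp
    have zero: "mat_trace (0\<^sub>m n n :: complex mat) = 0" by (simp add: mat_trace_def)
    have "E = R * 0\<^sub>m n n - R * (mat_adjoint D * \<Phi>) - R * (mat_adjoint \<Phi> * D)"
      unfolding E_def using c' R(1) by (simp add: mult_minus_distrib_mat[of _ n n _ n] minus_carrier_mat)
    then show ?thesis
      using 2 3 c' R(1) by (simp add: mat_trace_minus[of _ n] minus_carrier_mat zero) 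
  qed
  ultimately have "((\<lambda>t. det (R * Kt t)) has_vector_derivative - \<tau> - cnj \<tau>) (at 0)" by simp
  \<comment> \<open>The bound is expressed through the real part of the determinant, and -\<tau> -
    \<open>cnj \<tau>\<close> is the real number -2 Re \<tau>.\<close>
  from bounded_linear.has_vector_derivative[OF bounded_linear_Re this]
  have deriv: "((\<lambda>t. Re (det (R * Kt t))) has_real_derivative - 2 * Re \<tau>) (at 0)"
    by (simp add: has_real_derivative_iff_has_vector_derivative)
  have detK: "det K = complex_of_real d" "d > 0"
    using chernoff_one[OF \<rho> \<Phi>] by (auto simp: d_def K_def complex_eq_iff)
  have det: "det (Kt t) = complex_of_real d * det (R * Kt t)" for t
  proof -
    have "Kt t = K * (R * Kt t)"
      using assoc_mult_mat[OF K R(1) Kt[of t]] R Kt[of t] by simp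
    also have "det \<dots> = det K * det (R * Kt t)"
      using K R(1) Kt[of t] by (intro det_mult) auto
    finally show ?thesis using detK by simp
  qed
  have eq: "chernoff \<rho> N (V t) \<Phi>
      = alpha \<rho> ^ (n * N) / (2 * d ^ N) * inverse (Re (det (R * Kt t))) ^ N" for t
  proof -
    have "chernoff \<rho> N (V t) \<Phi> = alpha \<rho> ^ (n * N) / (2 * Re (det (Kt t)) ^ N)"
      unfolding Kt_def C_def by (rule chernoff_unitary(3)[OF \<rho> V \<Phi>])
    also have "Re (det (Kt t)) = d * Re (det (R * Kt t))"
      by (simp add: det)
    finally show ?thesis
      by (simp add: power_mult_distrib field_simps)
  qed
  have at0: "Re (det (R * Kt 0)) = 1" using R \<open>Kt 0 = K\<close> by simp
  \<comment> \<open>Because the value at 0 is 1, inverting only flips the sign of the slope, and the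
    power rule then contributes just the factor N.\<close>
  have "((\<lambda>t. inverse (Re (det (R * Kt t)))) has_real_derivative 2 * Re \<tau>) (at 0)"
    using DERIV_inverse'[OF deriv] at0 by simp
  from DERIV_cmult[OF DERIV_power[OF this, of N], of "alpha \<rho> ^ (n * N) / (2 * d ^ N)"]
  have "((\<lambda>t. alpha \<rho> ^ (n * N) / (2 * d ^ N) * inverse (Re (det (R * Kt t))) ^ N)
      has_real_derivative 2 * real N * (alpha \<rho> ^ (n * N) / (2 * d ^ N)) * Re \<tau>) (at 0)"
    by (simp add: at0 mult_ac)
  moreover have "chernoff \<rho> N (1\<^sub>m n) \<Phi> = alpha \<rho> ^ (n * N) / (2 * d ^ N)"
    using eq[of 0] at0 V0 by simp
  ultimately show ?thesis by (simp only: eq \<tau>_def)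
qed

section \<open>Plane rotations and diagonal phase matrices\<close>

text \<open>\<open>Upq\<close> with phase zero is the case \<open>a = 0\<close>; free 0-based axes
  make the family closed under padding by a leading 1.\<close>

definition plane_rot :: "nat \<Rightarrow> nat \<Rightarrow> nat \<Rightarrow> real \<Rightarrow> complex mat" where
  "plane_rot n a b t = mat n n (\<lambda>(i, j).
     if i = j then (if i = a \<or> i = b then complex_of_real (cos t) else 1)
     else if i = a \<and> j = b then - complex_of_real (sin t)
     else if i = b \<and> j = a then complex_of_real (sin t)
     else 0)"

lemma plane_rot_carrier [simp, intro]: "plane_rot n a b t \<in> carrier_mat n n"
  by (simp add: plane_rot_def)

lemma dim_plane_rot [simp]: "dim_row (plane_rot n a b t) = n" "dim_col (plane_rot n a b t) = n"
  by (simp_all add: plane_rot_def)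

lemma plane_rot_zero [simp]: "plane_rot n a b 0 = 1\<^sub>m n"
  by (rule eq_matI) (auto simp: plane_rot_def)

text \<open>A row of a rotation has at most two nonzero entries. Taking for \<open>f\<close> a
  column of a second rotation reduces their product to the addition theorems.\<close>

lemma plane_rot_row_sum:
  assumes "a < n" "b < n" "a \<noteq> b" "i < n"
  shows "(\<Sum>k<n. plane_rot n a b t $$ (i, k) * f k) =
    (if i = a then complex_of_real (cos t) * f a - complex_of_real (sin t) * f b
     else if i = b then complex_of_real (sin t) * f a + complex_of_real (cos t) * f b
     else f i)"
proof -
  consider "i = a" | "i = b" | "i \<noteq> a" "i \<noteq> b" by blast
  then show ?thesis
  proof cases
    case 1
    then have "(\<Sum>k<n. plane_rot n a b t $$ (i, k) * f k) =
      (\<Sum>k<n. (if k = a then complex_of_real (cos t) * f a else 0) - (if k = b then complex_of_real (sin t) * f b else 0))"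
      using assms by (intro sum.cong) (auto simp: plane_rot_def)
    then show ?thesis using assms 1 by (simp add: sum_subtractf)
  next
    case 2
    then have "(\<Sum>k<n. plane_rot n a b t $$ (i, k) * f k) =
      (\<Sum>k<n. (if k = a then complex_of_real (sin t) * f a else 0) + (if k = b then complex_of_real (cos t) * f b else 0))"
      using assms by (intro sum.cong) (auto simp: plane_rot_def)
    then show ?thesis using assms 2 by (simp add: sum.distrib)
  next
    case 3
    then have "(\<Sum>k<n. plane_rot n a b t $$ (i, k) * f k) = (\<Sum>k<n. if k = i then f i else 0)"
      using assms by (intro sum.cong) (auto simp: plane_rot_def)
    then show ?thesis using assms 3 by simp
  qed
qed

lemma plane_rot_add:
  assumes "a < n" "b < n" "a \<noteq> b"
  shows "plane_rot n a b s * plane_rot n a b t = plane_rot n a b (s + t)"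
proof (rule eq_matI)
  fix i j assume "i < dim_row (plane_rot n a b (s + t))" "j < dim_col (plane_rot n a b (s + t))"
  then have ij: "i < n" "j < n" by auto
  then have "(plane_rot n a b s * plane_rot n a b t) $$ (i, j)
      = (\<Sum>k<n. plane_rot n a b s $$ (i, k) * plane_rot n a b t $$ (k, j))"
    by (simp add: scalar_prod_def lessThan_atLeast0)
  also have "\<dots> = plane_rot n a b (s + t) $$ (i, j)"
    unfolding plane_rot_row_sum[OF assms ij(1)] using assms ij
    by (auto simp: plane_rot_def cos_add sin_add)
  finally show "(plane_rot n a b s * plane_rot n a b t) $$ (i, j) = plane_rot n a b (s + t) $$ (i, j)" .
qed auto

text \<open>The adjoint is the rotation by the opposite angle, so additivity in the angle gives
  unitarity.\<close>

lemma unitary_plane_rot: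
  assumes "a < n" "b < n" "a \<noteq> b"
  shows "unitary_mat n (plane_rot n a b t)"
proof -
  have "mat_adjoint (plane_rot n a b t) = plane_rot n a b (- t)"
    by (rule eq_matI) (auto simp: plane_rot_def)
  then show ?thesis
    by (simp add: unitary_mat_def plane_rot_add[OF assms])
qed

lemma unitary_mat_diag_cis: "unitary_mat n (mat_diag n (\<lambda>j. cis (f j)))"
proof -
  have "mat_adjoint (mat_diag n (\<lambda>j. cis (f j))) = mat_diag n (\<lambda>j. cis (- f j))"
    by (rule eq_matI) (auto simp: mat_diag_def cis_cnj)
  then show ?thesis by (simp add: unitary_mat_def cis_mult)
qed

lemma plane_rot_has_mat_derivative:
  assumes "a \<noteq> b"
  shows "has_mat_derivative (plane_rot n a b) n
    (mat n n (\<lambda>(i, j). if i = b \<and> j = a then 1 else if i = a \<and> j = b then - 1 else 0)) 0"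
proof -
  have "((\<lambda>t. complex_of_real (cos t)) has_vector_derivative complex_of_real 0) (at 0)"
    "((\<lambda>t. complex_of_real (sin t)) has_vector_derivative complex_of_real 1) (at 0)"
    by (intro has_vector_derivative_of_real; auto intro!: derivative_eq_intros)+
  moreover from has_vector_derivative_minus[OF this(2)]
  have "((\<lambda>t. - complex_of_real (sin t)) has_vector_derivative - 1) (at 0)" by simp
  ultimately have "((\<lambda>t. plane_rot n a b t $$ (i, j)) has_vector_derivative
      (if i = b \<and> j = a then 1 else if i = a \<and> j = b then - 1 else 0)) (at 0)" if "i < n" "j < n" for i j
    using assms that
    by (cases "i = j"; cases "i = a"; cases "i = b"; cases "j = a"; cases "j = b")
      (simp_all add: plane_rot_def)
  then show ?thesis by (simp add: has_mat_derivative_def)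
qed

lemma mat_diag_cis_has_mat_derivative:
  "has_mat_derivative (\<lambda>t. mat_diag n (\<lambda>j. cis (f j * t))) n
    (mat_diag n (\<lambda>j. \<i> * complex_of_real (f j))) 0"
proof -
  have "((\<lambda>t. cis (f j * t)) has_vector_derivative \<i> * complex_of_real (f j)) (at 0)" for j
    unfolding has_vector_derivative_def
    by (auto intro!: derivative_eq_intros simp: scaleR_conv_of_real)
  then show ?thesis by (auto simp: has_mat_derivative_def mat_diag_def)
qed

lemma mat_trace_mult_adjoint:
  fixes A B :: "complex mat"
  assumes "A \<in> carrier_mat n n" "B \<in> carrier_mat n n"
  shows "mat_trace (A * mat_adjoint B) = (\<Sum>i<n. \<Sum>j<n. A $$ (i, j) * cnj (B $$ (i, j)))"
  using assms by (subst mat_trace_mult[of _ n n]) auto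

section \<open>The parameterization restricted to the coordinate axes\<close>

text \<open>Collapses the ordered product in \<open>Fmat\<close> when at most one angle is nonzero;
  distinctness ensures that the exceptional factor occurs at most once.\<close>

lemma foldr_mult_single:
  fixes G :: "nat \<Rightarrow> 'a :: semiring_1 mat"
  assumes "distinct qs" and "\<And>x. x \<noteq> q \<Longrightarrow> G x = 1\<^sub>m n" and "G q \<in> carrier_mat n n"
  shows "foldr (\<lambda>x B. G x * B) qs (1\<^sub>m n) = (if q \<in> set qs then G q else 1\<^sub>m n)"
  using assms(1)
proof (induction qs)
  case (Cons x qs)
  then show ?case using assms(2)[of x] assms(3) by (cases "x = q") auto
qed simp

text \<open>The phase occurs only multiplied by sin \<phi>; this is the source of the vanishing
  \<nu> derivatives.\<close>

lemma Upq_angle_zero: "\<phi> p q = 0 \<Longrightarrow> Upq M \<phi> \<nu> p q = 1\<^sub>m (M - p + 1)"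
  by (rule eq_matI) (auto simp: Upq_def)

lemma Upq_plane_rot:
  "p < q \<Longrightarrow> \<nu> p q = 0 \<Longrightarrow> Upq M \<phi> \<nu> p q = plane_rot (M - p + 1) 0 (q - p) (\<phi> p q)"
  by (rule eq_matI) (auto simp: Upq_def plane_rot_def)

lemma Fmat_angles_zero:
  assumes "\<And>q. \<phi> r q = 0"
  shows "Fmat M \<phi> \<nu> r = 1\<^sub>m (M - r + 1)"
  \<comment> \<open>The index 0 lies outside the list, so the product is the identity.\<close>
  using foldr_mult_single[of "[r + 1..<M + 1]" 0 "Upq M \<phi> \<nu> r" "M - r + 1"] assms
  by (simp add: Fmat_def Upq_angle_zero)

lemma Fmat_single:
  assumes "p < q" "q \<le> M"
  shows "Fmat M ((\<lambda>_ _. 0)(p := (\<lambda>_. 0)(q := t))) (\<lambda>_ _. 0) p = plane_rot (M - p + 1) 0 (q - p) t"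
    (is "Fmat M ?\<phi> _ p = _")
proof -
  have "Upq M ?\<phi> (\<lambda>_ _. 0) p q = plane_rot (M - p + 1) 0 (q - p) t"
    using assms by (simp add: Upq_plane_rot)
  moreover have "Upq M ?\<phi> (\<lambda>_ _. 0) p x = 1\<^sub>m (M - p + 1)" if "x \<noteq> q" for x
    using that by (simp add: Upq_angle_zero)
  ultimately show ?thesis
    using foldr_mult_single[of "[p + 1..<M + 1]" q "Upq M ?\<phi> (\<lambda>_ _. 0) p" "M - p + 1"] assms
    by (simp add: Fmat_def del: upt_Suc)
qed

text \<open>Padding by a leading 1 shifts both axes by one; this is one step of the recursion for
  \<open>scrU\<close> once the rotation is present.\<close>

lemma four_block_plane_rot:
  "four_block_mat (mat 1 1 (\<lambda>_. 1)) (0\<^sub>m 1 n) (0\<^sub>m n 1) (plane_rot n a b t)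
    = plane_rot (Suc n) (Suc a) (Suc b) t"
proof (rule eq_matI)
  fix i j
  assume "i < dim_row (plane_rot (Suc n) (Suc a) (Suc b) t)"
    "j < dim_col (plane_rot (Suc n) (Suc a) (Suc b) t)"
  then show "four_block_mat (mat 1 1 (\<lambda>_. 1)) (0\<^sub>m 1 n) (0\<^sub>m n 1) (plane_rot n a b t) $$ (i, j)
      = plane_rot (Suc n) (Suc a) (Suc b) t $$ (i, j)"
    by (cases i; cases j) (simp_all add: plane_rot_def)
qed simp_all

lemma four_block_one:
  "four_block_mat (mat 1 1 (\<lambda>_. 1)) (0\<^sub>m 1 n) (0\<^sub>m n 1) (1\<^sub>m n) = 1\<^sub>m (Suc n)"
  by (rule eq_matI) auto

lemma four_block_mat_diag:
  "four_block_mat (mat 1 1 (\<lambda>_. f 0)) (0\<^sub>m 1 n) (0\<^sub>m n 1) (mat_diag n (\<lambda>j. f (Suc j)))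
    = mat_diag (Suc n) f"
  by (rule eq_matI) (auto simp: mat_diag_def)

text \<open>All factors \<open>Fmat\<close> are identities, so each step only prepends one phase;
  stage \<open>k\<close> carries the phases with indices from M - k to M.\<close>

lemma scrU_diagonal:
  assumes "1 \<le> k" "k < M"
  shows "scrU M (\<lambda>_ _. 0) \<nu> \<theta> k = mat_diag (k + 1) (\<lambda>j. cis (\<theta> (M - k + j)))"
  using assms
proof (induction k rule: nat_induct_at_least)
  case base
  then show ?case by (intro eq_matI) (auto simp: mat_diag_def less_Suc_eq)
next
  case (Suc k)
  then obtain k' where k: "k = Suc k'" by (cases k) auto
  have "scrU M (\<lambda>_ _. 0) \<nu> \<theta> k * Fmat M (\<lambda>_ _. 0) \<nu> (M - k)
      = mat_diag (k + 1) (\<lambda>j. cis (\<theta> (M - k + j)))"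
    using Suc by (simp add: Fmat_angles_zero right_mult_one_mat[OF mat_diag_dim])
  \<comment> \<open>Subtraction is truncated, so this shift relies on
    \<open>Suc k < M\<close>.\<close>
  moreover have "M - k + j = M - Suc k + Suc j" for j using Suc by simp
  moreover have "M - k - 1 = M - Suc k + 0" by simp
  ultimately show ?case
    using four_block_mat_diag[of "\<lambda>j. cis (\<theta> (M - Suc k + j))" "k + 1"]
    unfolding k scrU.simps by simp
qed

lemma Upar_diagonal:
  assumes "M \<ge> 2"
  shows "Upar M (\<lambda>_ _. 0) \<nu> \<theta> = mat_diag M (\<lambda>j. cis (\<theta> (j + 1)))"
proof -
  have "M - (M - 1) + j = j + 1" for j using assms by simp
  moreover have "M - 1 + 1 = M" using assms by simp
  ultimately show ?thesis
    using assms scrU_diagonal[of "M - 1" M \<nu> \<theta>]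
    by (simp only: Upar_def) (simp add: Fmat_angles_zero right_mult_one_mat[OF mat_diag_dim])
qed

text \<open>Stage \<open>k\<close> occupies the coordinates M - k to M and has absorbed the factors
  \<open>Fmat\<close> with index above M - k. So the rotation is present exactly when M - k < p, and
  its axes are counted from the start of the block.\<close>

lemma scrU_rotation:
  assumes "1 \<le> k" "k < M" and pq: "p < q" "q \<le> M"
  shows "scrU M ((\<lambda>_ _. 0)(p := (\<lambda>_. 0)(q := t))) (\<lambda>_ _. 0) (\<lambda>_. 0) k =
    (if M - k < p then plane_rot (k + 1) (p - (M - k)) (q - (M - k)) t else 1\<^sub>m (k + 1))"
    (is "scrU M ?\<phi> _ _ k = _")
  using assms(1,2)
proof (induction k rule: nat_induct_at_least)
  case base
  \<comment> \<open>At k = 1 the rotation cannot be present, since p < q \<le> M excludes M - 1 <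
    p.\<close>
  then show ?case using pq by (intro eq_matI) (auto simp: less_Suc_eq)
next
  case (Suc k)
  obtain k' where k: "k = Suc k'" using Suc by (cases k) auto
  define Z where "Z = scrU M ?\<phi> (\<lambda>_ _. 0) (\<lambda>_. 0) k * Fmat M ?\<phi> (\<lambda>_ _. 0) (M - k)"
  have step: "scrU M ?\<phi> (\<lambda>_ _. 0) (\<lambda>_. 0) (Suc k) =
      four_block_mat (mat 1 1 (\<lambda>_. 1)) (0\<^sub>m 1 (k + 1)) (0\<^sub>m (k + 1) 1) Z"
    unfolding Z_def k by simp
  have dim: "M - (M - k) + 1 = k + 1" using Suc by simp
  have F: "Fmat M ?\<phi> (\<lambda>_ _. 0) (M - k) = 1\<^sub>m (k + 1)" if "p \<noteq> M - k"
    using that Fmat_angles_zero[of ?\<phi> "M - k" M] dim by simp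
  have IH: "scrU M ?\<phi> (\<lambda>_ _. 0) (\<lambda>_. 0) k =
    (if M - k < p then plane_rot (k + 1) (p - (M - k)) (q - (M - k)) t else 1\<^sub>m (k + 1))"
    using Suc.prems by (intro Suc.IH) simp
  \<comment> \<open>The rotation is still to come, enters at this step through \<open>Fmat\<close>,
    or is already in the block and gets shifted.\<close>
  consider "p < M - k" | "p = M - k" | "M - k < p" by linarith
  then show ?case
  proof cases
    case 1
    then have "Z = 1\<^sub>m (k + 1)" unfolding Z_def IH using F by simp
    then show ?thesis using 1 four_block_one[of "k + 1"] unfolding step by auto
  next
    case 2
    then have "Fmat M ?\<phi> (\<lambda>_ _. 0) (M - k) = plane_rot (k + 1) 0 (q - p) t"
      using Fmat_single[OF pq, of t] dim by simp
    then have "Z = plane_rot (k + 1) 0 (q - p) t" unfolding Z_def IH using 2 by simp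
    moreover have "M - Suc k < p" "p - (M - Suc k) = Suc 0" "q - (M - Suc k) = Suc (q - p)"
      using 2 Suc.prems pq by auto
    ultimately show ?thesis
      using four_block_plane_rot[of "k + 1" 0 "q - p" t] unfolding step by simp
  next
    case 3
    then have "Z = plane_rot (k + 1) (p - (M - k)) (q - (M - k)) t" unfolding Z_def IH using F by simp
    moreover have "M - Suc k < p" "p - (M - Suc k) = Suc (p - (M - k))" "q - (M - Suc k) = Suc (q - (M - k))"
      using 3 Suc.prems pq by auto
    ultimately show ?thesis
      using four_block_plane_rot[of "k + 1" "p - (M - k)" "q - (M - k)" t] unfolding step by simp
  qed
qed

lemma Upar_rotation:
  assumes "M \<ge> 2" and pq: "1 \<le> p" "p < q" "q \<le> M"
  shows "Upar M ((\<lambda>_ _. 0)(p := (\<lambda>_. 0)(q := t))) (\<lambda>_ _. 0) (\<lambda>_. 0) = plane_rot M (p - 1) (q - 1) t"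
    (is "Upar M ?\<phi> _ _ = _")
proof -
  have M: "M - 1 + 1 = M" "M - (M - 1) = 1" "1 \<le> M - 1" "M - 1 < M" using assms by auto
  have S: "scrU M ?\<phi> (\<lambda>_ _. 0) (\<lambda>_. 0) (M - 1) = (if 1 < p then plane_rot M (p - 1) (q - 1) t else 1\<^sub>m M)"
    using scrU_rotation[OF M(3,4) pq(2,3), of t] unfolding M .
  show ?thesis
  \<comment> \<open>The factor with index 1 is multiplied last, in \<open>Upar\<close> itself, so
    for p = 1 the rotation comes from there and otherwise from \<open>scrU\<close>.\<close>
  proof (cases "p = 1")
    case True
    then show ?thesis unfolding Upar_def S using Fmat_single[OF pq(2,3), of t] M by simp
  next
    case False
    then show ?thesis unfolding Upar_def S using Fmat_angles_zero[of ?\<phi> 1 M] M pq by simp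
  qed
qed

section \<open>Powers of the diagonal constellation, and the derivatives in the individual
  directions\<close>

lemma Lambda_mat_power:
  "Lambda_mat M L lam ^\<^sub>m l = mat_diag M (\<lambda>j. cis (real l * (2 * pi * lam (j + 1) / real L)))"
proof (induction l)
  case 0
  then show ?case by (simp add: Lambda_mat_def carrier_matD[OF mat_diag_dim])
next
  case (Suc l)
  then show ?case by (simp add: Lambda_mat_def cis_mult algebra_simps add_divide_distrib)
qed

text \<open>The velocity of the rotation has entry 1 at (b, a) and -1 at (a, b), so the trace
  against its adjoint picks out two entries of \<open>Qmat\<close>.\<close>

lemma chernoff_derivative_plane_rot:
  assumes \<rho>: "\<rho> > 0" and \<Phi>: "unitary_mat n \<Phi>" and ab: "a < n" "b < n" "a \<noteq> b"
  shows "((\<lambda>t. chernoff \<rho> N (plane_rot n a b t) \<Phi>) has_real_derivative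
    2 * real N * chernoff \<rho> N (1\<^sub>m n) \<Phi> * Re (Qmat \<rho> n \<Phi> $$ (b, a) - Qmat \<rho> n \<Phi> $$ (a, b))) (at 0)"
proof -
  define D :: "complex mat"
    where "D = mat n n (\<lambda>(i, j). if i = b \<and> j = a then 1 else if i = a \<and> j = b then - 1 else 0)"
  let ?Q = "Qmat \<rho> n \<Phi>"
  have Q: "?Q \<in> carrier_mat n n"
    using Kmat_inverse(1)[OF \<rho> \<Phi>] \<Phi> by (auto simp: Qmat_def unitary_mat_def)
  have "mat_trace (?Q * mat_adjoint D) = (\<Sum>i<n. \<Sum>j<n. ?Q $$ (i, j) * cnj (D $$ (i, j)))"
    using Q by (intro mat_trace_mult_adjoint) (auto simp: D_def)
  also have "\<dots> = (\<Sum>i<n. (if i = b then ?Q $$ (b, a) else 0) - (if i = a then ?Q $$ (a, b) else 0))"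
  proof (intro sum.cong refl)
    fix i assume "i \<in> {..<n}"
    then have "(\<Sum>j<n. ?Q $$ (i, j) * cnj (D $$ (i, j)))
      = (\<Sum>j<n. (if j = a then (if i = b then ?Q $$ (b, a) else 0) else 0)
          - (if j = b then (if i = a then ?Q $$ (a, b) else 0) else 0))"
      using ab by (intro sum.cong) (auto simp: D_def)
    then show "(\<Sum>j<n. ?Q $$ (i, j) * cnj (D $$ (i, j)))
      = (if i = b then ?Q $$ (b, a) else 0) - (if i = a then ?Q $$ (a, b) else 0)"
      using ab by (simp add: sum_subtractf)
  qed
  also have "\<dots> = ?Q $$ (b, a) - ?Q $$ (a, b)"
    using ab by (simp add: sum_subtractf)
  finally show ?thesis
    using chernoff_has_derivative_at_one[OF \<rho> \<Phi> unitary_plane_rot[OF ab] plane_rot_zero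
        plane_rot_has_mat_derivative[OF ab(3)], of N]
    by (simp add: D_def)
qed

text \<open>The velocity is \<open>\<i> * c\<close> at position (k, k); conjugation turns
  \<open>\<i>\<close> into \<open>- \<i>\<close>, hence the imaginary part. The speed
  \<open>c\<close> allows one lemma for both \<theta> and \<lambda>.\<close>

lemma chernoff_derivative_phase:
  assumes \<rho>: "\<rho> > 0" and \<Phi>: "unitary_mat n \<Phi>" and k: "k < n"
  shows "((\<lambda>t. chernoff \<rho> N (mat_diag n (\<lambda>j. cis ((if j = k then c else 0) * t))) \<Phi>) has_real_derivative
    2 * real N * chernoff \<rho> N (1\<^sub>m n) \<Phi> * (c * Im (Qmat \<rho> n \<Phi> $$ (k, k)))) (at 0)"
proof -
  define f where "f = (\<lambda>j. if j = k then c else 0 :: real)"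
  define D where "D = mat_diag n (\<lambda>j. \<i> * complex_of_real (f j))"
  let ?Q = "Qmat \<rho> n \<Phi>"
  have Q: "?Q \<in> carrier_mat n n"
    using Kmat_inverse(1)[OF \<rho> \<Phi>] \<Phi> by (auto simp: Qmat_def unitary_mat_def)
  have "mat_trace (?Q * mat_adjoint D) = (\<Sum>i<n. \<Sum>j<n. ?Q $$ (i, j) * cnj (D $$ (i, j)))"
    using Q by (intro mat_trace_mult_adjoint) (auto simp: D_def)
  also have "\<dots> = (\<Sum>i<n. if i = k then - \<i> * complex_of_real c * ?Q $$ (k, k) else 0)"
  proof (intro sum.cong refl)
    fix i assume "i \<in> {..<n}"
    moreover from this have "(\<Sum>j<n. ?Q $$ (i, j) * cnj (D $$ (i, j)))
      = (\<Sum>j<n. if j = i then (if i = k then - \<i> * complex_of_real c * ?Q $$ (k, k) else 0) else 0)"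
      by (intro sum.cong) (auto simp: D_def mat_diag_def f_def)
    ultimately show "(\<Sum>j<n. ?Q $$ (i, j) * cnj (D $$ (i, j)))
      = (if i = k then - \<i> * complex_of_real c * ?Q $$ (k, k) else 0)"
      by simp
  qed
  also have "\<dots> = - \<i> * complex_of_real c * ?Q $$ (k, k)"
    using k by simp
  finally have "Re (mat_trace (?Q * mat_adjoint D)) = c * Im (?Q $$ (k, k))" by simp
  then show ?thesis
    using chernoff_has_derivative_at_one[OF \<rho> \<Phi> unitary_mat_diag_cis _
        mat_diag_cis_has_mat_derivative[of n f], of N]
    by (simp add: D_def f_def)
qed

text \<open>Partial derivatives at zero are derivatives along coordinate lines, written with
  function updates. The first identity is over the complex numbers because \<open>det\<close> takes
  complex values.\<close>

theorem theorem2: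
  fixes \<rho> :: real and M N L l :: nat and \<Phi> :: "complex mat"
  assumes "\<rho> > 0" and "M \<ge> 2" and "N \<ge> 1" and "L \<ge> 1" and "l < L"
    and "unitary_mat M \<Phi>"
  shows
    "complex_of_real (chernoff \<rho> N (1\<^sub>m M) \<Phi>)
       = complex_of_real (alpha \<rho> ^ (M * N)) / (2 * det (Kmat \<rho> M \<Phi>) ^ N)
     \<and> (\<forall>p q. 1 \<le> p \<and> p < q \<and> q \<le> M \<longrightarrow>
          ((\<lambda>t. chernoff \<rho> N (Upar M ((\<lambda>_ _. 0)(p := (\<lambda>_. 0)(q := t))) (\<lambda>_ _. 0) (\<lambda>_. 0)) \<Phi>)
            has_real_derivative
              2 * real N * chernoff \<rho> N (1\<^sub>m M) \<Phi>
                * Re (Qmat \<rho> M \<Phi> $$ (q - 1, p - 1) - Qmat \<rho> M \<Phi> $$ (p - 1, q - 1))) (at 0))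
     \<and> (\<forall>k. 1 \<le> k \<and> k \<le> M \<longrightarrow>
          ((\<lambda>t. chernoff \<rho> N (Upar M (\<lambda>_ _. 0) (\<lambda>_ _. 0) ((\<lambda>_. 0)(k := t))) \<Phi>)
            has_real_derivative
              2 * real N * chernoff \<rho> N (1\<^sub>m M) \<Phi> * Im (Qmat \<rho> M \<Phi> $$ (k - 1, k - 1))) (at 0))
     \<and> (\<forall>p q. 1 \<le> p \<and> p < q \<and> q \<le> M \<longrightarrow>
          ((\<lambda>t. chernoff \<rho> N (Upar M (\<lambda>_ _. 0) ((\<lambda>_ _. 0)(p := (\<lambda>_. 0)(q := t))) (\<lambda>_. 0)) \<Phi>)
            has_real_derivative 0) (at 0))
     \<and> (\<forall>m. 1 \<le> m \<and> m \<le> M \<longrightarrow>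
          ((\<lambda>t. chernoff \<rho> N (Lambda_mat M L ((\<lambda>_. 0)(m := t)) ^\<^sub>m l) \<Phi>)
            has_real_derivative
              4 * pi * real N * real l / real L * chernoff \<rho> N (1\<^sub>m M) \<Phi>
                * Im (Qmat \<rho> M \<Phi> $$ (m - 1, m - 1))) (at 0))"
proof (intro conjI allI impI)
  note \<rho> = assms(1) and \<Phi> = assms(6)
  have "det (Kmat \<rho> M \<Phi>) = complex_of_real (Re (det (Kmat \<rho> M \<Phi>)))"
    using chernoff_one(1)[OF \<rho> \<Phi>] by (simp add: complex_eq_iff)
  then show "complex_of_real (chernoff \<rho> N (1\<^sub>m M) \<Phi>)
      = complex_of_real (alpha \<rho> ^ (M * N)) / (2 * det (Kmat \<rho> M \<Phi>) ^ N)"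
    unfolding chernoff_one(3)[OF \<rho> \<Phi>]
    by (metis of_real_divide of_real_mult of_real_numeral of_real_power)
next
  fix p q assume "1 \<le> p \<and> p < q \<and> q \<le> M"
  then have pq: "1 \<le> p" "p < q" "q \<le> M" by auto
  then have "p - 1 < M" "q - 1 < M" "p - 1 \<noteq> q - 1" by auto
  from chernoff_derivative_plane_rot[OF assms(1,6) this, of N]
  show "((\<lambda>t. chernoff \<rho> N (Upar M ((\<lambda>_ _. 0)(p := (\<lambda>_. 0)(q := t))) (\<lambda>_ _. 0) (\<lambda>_. 0)) \<Phi>)
      has_real_derivative 2 * real N * chernoff \<rho> N (1\<^sub>m M) \<Phi>
        * Re (Qmat \<rho> M \<Phi> $$ (q - 1, p - 1) - Qmat \<rho> M \<Phi> $$ (p - 1, q - 1))) (at 0)"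
    unfolding Upar_rotation[OF assms(2) pq] .
next
  fix k assume k: "1 \<le> k \<and> k \<le> M"
  then have less: "k - 1 < M" by auto
  from k have "Upar M (\<lambda>_ _. 0) (\<lambda>_ _. 0) ((\<lambda>_. 0)(k := t))
      = mat_diag M (\<lambda>j. cis ((if j = k - 1 then 1 else 0) * t))" for t
    unfolding Upar_diagonal[OF assms(2)] by (intro arg_cong[where f = "mat_diag M"]) (auto simp: fun_eq_iff)
  then show "((\<lambda>t. chernoff \<rho> N (Upar M (\<lambda>_ _. 0) (\<lambda>_ _. 0) ((\<lambda>_. 0)(k := t))) \<Phi>)
      has_real_derivative 2 * real N * chernoff \<rho> N (1\<^sub>m M) \<Phi>
        * Im (Qmat \<rho> M \<Phi> $$ (k - 1, k - 1))) (at 0)"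
    using chernoff_derivative_phase[OF assms(1,6) less, of N 1] by simp
next
  fix p q assume "1 \<le> p \<and> p < q \<and> q \<le> M"
  show "((\<lambda>t. chernoff \<rho> N (Upar M (\<lambda>_ _. 0) ((\<lambda>_ _. 0)(p := (\<lambda>_. 0)(q := t))) (\<lambda>_. 0)) \<Phi>)
      has_real_derivative 0) (at 0)"
    \<comment> \<open>With all \<phi> equal to zero the matrix does not depend on \<nu>, so the
      function is constant.\<close>
    unfolding Upar_diagonal[OF assms(2)] by simp
next
  fix m assume m: "1 \<le> m \<and> m \<le> M"
  then have less: "m - 1 < M" by auto
  from m have "Lambda_mat M L ((\<lambda>_. 0)(m := t)) ^\<^sub>m l
      = mat_diag M (\<lambda>j. cis ((if j = m - 1 then 2 * pi * real l / real L else 0) * t))" for t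
    \<comment> \<open>The power \<open>l\<close> multiplies the phase speed, which becomes 2 \<pi> l
      / L.\<close>
    unfolding Lambda_mat_power by (intro arg_cong[where f = "mat_diag M"]) (auto simp: fun_eq_iff mult_ac)
  then show "((\<lambda>t. chernoff \<rho> N (Lambda_mat M L ((\<lambda>_. 0)(m := t)) ^\<^sub>m l) \<Phi>)
      has_real_derivative 4 * pi * real N * real l / real L * chernoff \<rho> N (1\<^sub>m M) \<Phi>
        * Im (Qmat \<rho> M \<Phi> $$ (m - 1, m - 1))) (at 0)"
    using chernoff_derivative_phase[OF assms(1,6) less, of N "2 * pi * real l / real L"]
    by (simp add: mult_ac)
qed

end
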